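(* Let $k$ be the optimal value of the problem $(P_0)$: $\min_{x\in R^n}\|x\|_0$ subject to $\|y-Ax\|_2\le\epsilon$, $Bx\le b$. The sparsest solution set $\Lambda=\{x\in R^n:\|x\|_0=k,\ \|y-Ax\|_2\le\epsilon,\ Bx\le b\}$ is bounded if one of the following conditions holds: (E1) For any $\Pi\subseteq\{1,\dots,n\}$ with $|\Pi|=k$, we have $\{\eta:A_\Pi\eta=0\}\cap\{\eta:B_\Pi\eta\le0\}=\{0\}$. (E2) Any $k$ columns of $A$ are linearly independent. (E3) $k<\mathrm{spark}(A)$, where $\mathrm{spark}(A)$ denotes the minimum number of linearly dependent columns of $A$.
   Context: Data: $A\in R^{m\times n}$, $B\in R^{l\times n}$ with $m\ll n$ (in particular $m<n$) and $l\le n$; $y\in R^m$, $b\in R^l$ are given vectors and $\epsilon\ge 0$ is a given parameter. $\|x\|_0$ is the number of nonzero components of $x$; $\|\cdot\|_2$ is the Euclidean norm; vector inequalities are understood componentwise. For an index set $\Pi$, $A_\Pi$ and $B_\Pi$ are the submatrices of $A$ and $B$ consisting of the columns indexed by $\Pi$, and $\eta$ ranges over $R^{|\Pi|}$. *)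

theory Defs
  imports
    "HOL-Analysis.Analysis"
    "HOL-Library.FuncSet"
    "HOL-Library.Extended_Nat"
begin

definition l0norm :: "real ^ 'n \<Rightarrow> nat"
  where "l0norm x = card {i. x $ i \<noteq> 0}"

definition feasible_set ::
  "real ^ 'n ^ 'm \<Rightarrow> real ^ 'm \<Rightarrow> real \<Rightarrow> real ^ 'n ^ 'l \<Rightarrow> real ^ 'l \<Rightarrow> (real ^ 'n) set"
  where "feasible_set A y \<epsilon> B b = {x. norm (y - A *v x) \<le> \<epsilon> \<and> B *v x \<le> b}"

text \<open>The optimal value of the problem of minimising \<open>l0norm\<close> over the feasible set. It is
  attained as soon as the problem is feasible, and it is \<open>\<infinity>\<close> if the problem is infeasible.\<close>

definition P0_value ::
  "real ^ 'n ^ 'm \<Rightarrow> real ^ 'm \<Rightarrow> real \<Rightarrow> real ^ 'n ^ 'l \<Rightarrow> real ^ 'l \<Rightarrow> enat"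
  where "P0_value A y \<epsilon> B b = (INF x\<in>feasible_set A y \<epsilon> B b. enat (l0norm x))"

definition sparsest_solutions ::
  "real ^ 'n ^ 'm \<Rightarrow> real ^ 'm \<Rightarrow> real \<Rightarrow> real ^ 'n ^ 'l \<Rightarrow> real ^ 'l \<Rightarrow> (real ^ 'n) set"
  where "sparsest_solutions A y \<epsilon> B b =
    {x. enat (l0norm x) = P0_value A y \<epsilon> B b \<and> norm (y - A *v x) \<le> \<epsilon> \<and> B *v x \<le> b}"

text \<open>For an index set \<open>S\<close>, the space of real vectors with \<open>card S\<close> entries is represented by
  the real functions on \<open>S\<close>, i.e. by \<open>S \<rightarrow>\<^sub>E UNIV\<close>; the functions in this set are
  \<open>undefined\<close> outside \<open>S\<close>, so its zero vector is the constant \<open>0\<close> restricted to \<open>S\<close>.\<close>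

definition subvectors :: "'n set \<Rightarrow> ('n \<Rightarrow> real) set"
  where "subvectors S = S \<rightarrow>\<^sub>E UNIV"

definition subvector_zero :: "'n set \<Rightarrow> 'n \<Rightarrow> real"
  where "subvector_zero S = (\<lambda>j\<in>S. 0)"

text \<open>The product of a vector with the submatrix consisting of the columns indexed by \<open>S\<close>.\<close>

definition submatrix_vector_mult :: "real ^ 'n ^ 'm \<Rightarrow> 'n set \<Rightarrow> ('n \<Rightarrow> real) \<Rightarrow> real ^ 'm"
  where "submatrix_vector_mult A S \<eta> = (\<chi> i. \<Sum>j\<in>S. A $ i $ j * \<eta> j)"

text \<open>Linear independence of the columns as an indexed family: injectivity is needed because
  two equal columns at different positions are linearly dependent, whereas \<open>independent\<close>
  only sees the set of columns.\<close>

definition independent_columns :: "real ^ 'n ^ 'm \<Rightarrow> 'n set \<Rightarrow> bool"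
  where "independent_columns A S \<longleftrightarrow>
    inj_on (\<lambda>j. column j A) S \<and> independent ((\<lambda>j. column j A) ` S)"

text \<open>The value is \<open>\<infinity>\<close> if all columns together are linearly independent, which is
  impossible for a matrix with more columns than rows.\<close>

definition spark :: "real ^ 'n ^ 'm \<Rightarrow> enat"
  where "spark A = (INF S\<in>{S. \<not> independent_columns A S}. enat (card S))"

end

theory Submission
  imports Defs
begin

text \<open>For a fixed support \<open>S\<close>, the positively homogeneous function
  \<open>x \<mapsto> \<parallel>A x\<parallel> + \<Sum>\<^sub>i max 0 (B x)\<^sub>i\<close> is bounded on the feasible set and, under any of the three
  conditions, positive on the nonzero vectors supported in \<open>S\<close>. By compactness of the unit sphere
  it therefore dominates a positive multiple of the norm there, so the feasible vectors supported
  in \<open>S\<close> are bounded. The solution set is contained in the union of these sets over the finitely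
  many \<open>S\<close> with \<open>k\<close> elements.\<close>

lemma positively_homogeneous_bounded_below:
  fixes f :: "'a::euclidean_space \<Rightarrow> real"
  assumes "continuous_on UNIV f" and "subspace V"
    and hom: "\<And>c x. c > 0 \<Longrightarrow> f (c *\<^sub>R x) = c * f x"
    and pos: "\<And>x. x \<in> V \<Longrightarrow> x \<noteq> 0 \<Longrightarrow> f x > 0"
  obtains \<delta> where "\<delta> > 0" "\<And>x. x \<in> V \<Longrightarrow> x \<noteq> 0 \<Longrightarrow> \<delta> * norm x \<le> f x"
proof (cases "sphere 0 1 \<inter> V = {}")
  case False
  have "compact (sphere 0 1 \<inter> V)"
    by (intro compact_Int_closed closed_subspace assms compact_sphere)
  then obtain d where d: "d \<in> sphere 0 1 \<inter> V" "\<And>x. x \<in> sphere 0 1 \<inter> V \<Longrightarrow> f d \<le> f x"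
    using continuous_attains_inf[OF _ False continuous_on_subset[OF assms(1)]] by blast
  show ?thesis
  proof
    show "f d > 0" using d(1) by (intro pos) auto
    fix x assume x: "x \<in> V" "x \<noteq> 0"
    have "f d \<le> f (inverse (norm x) *\<^sub>R x)"
      using x assms(2) by (intro d(2)) (auto intro: subspace_scale)
    then show "f d * norm x \<le> f x"
      using x by (simp add: hom field_simps)
  qed
next
  case True
  \<comment> \<open>A subspace that misses the unit sphere is trivial, so the bound is vacuous and
    \<delta> = 1 serves.\<close>
  have "x = 0" if "x \<in> V" for x
  proof (rule ccontr)
    assume "x \<noteq> 0"
    then have "inverse (norm x) *\<^sub>R x \<in> sphere 0 1 \<inter> V"
      using that assms(2) by (auto intro: subspace_scale)
    with True show False by blast
  qed
  then show ?thesis using that[of 1] by auto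
qed

lemma subspace_supported: "subspace {x :: real ^ 'n. \<forall>j. j \<notin> S \<longrightarrow> x $ j = 0}"
  by (auto simp: subspace_def)

text \<open>The assumption says that 0 is the only direction of recession: adding multiples of a
  vector with A x = 0 and B x \<le> 0 never leaves the feasible set.\<close>

lemma bounded_feasible_supported:
  fixes A :: "real ^ 'n ^ 'm" and B :: "real ^ 'n ^ 'l"
  assumes "\<And>x. \<forall>j. j \<notin> S \<longrightarrow> x $ j = 0 \<Longrightarrow> A *v x = 0 \<Longrightarrow> B *v x \<le> 0 \<Longrightarrow> x = 0"
  shows "bounded (feasible_set A y \<epsilon> B b \<inter> {x. \<forall>j. j \<notin> S \<longrightarrow> x $ j = 0})"
proof -
  \<comment> \<open>Both terms are nonnegative, and they vanish together exactly when A x = 0 and B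
    x \<le> 0. The positive part ignores negative entries of B x, so homogeneity holds for positive
    factors only.\<close>
  define f where "f x = norm (A *v x) + (\<Sum>i\<in>UNIV. max 0 ((B *v x) $ i))" for x
  have cont: "continuous_on UNIV f"
    unfolding f_def
    by (intro continuous_intros matrix_vector_mult_linear_continuous_on)
  have hom: "f (c *\<^sub>R x) = c * f x" if "c > 0" for c x
  proof -
    have "max 0 (c * t) = c * max 0 t" for t
      using that by (auto simp: max_def zero_le_mult_iff mult_le_0_iff)
    then show ?thesis
      using that by (simp add: f_def scaleR_matrix_vector_assoc[symmetric] matrix_vector_mult_scaleR
          sum_distrib_left distrib_left)
  qed
  have pos: "f x > 0" if x: "x \<in> {x. \<forall>j. j \<notin> S \<longrightarrow> x $ j = 0}" "x \<noteq> 0" for x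
  proof (rule ccontr)
    assume "\<not> f x > 0"
    moreover have "0 \<le> (\<Sum>i\<in>UNIV. max 0 ((B *v x) $ i))"
      by (intro sum_nonneg) auto
    ultimately have "norm (A *v x) = 0" "(\<Sum>i\<in>UNIV. max 0 ((B *v x) $ i)) = 0"
      unfolding f_def using norm_ge_zero[of "A *v x"] by linarith+
    then have "A *v x = 0" and "max 0 ((B *v x) $ i) = 0" for i
      by (simp_all add: sum_nonneg_eq_0_iff)
    moreover from this(2) have "B *v x \<le> 0"
      by (simp add: less_eq_vec_def max_def split: if_splits) (metis linear)
    ultimately show False using assms x by blast
  qed
  obtain \<delta> where \<delta>: "\<delta> > 0"
      "\<And>x. x \<in> {x. \<forall>j. j \<notin> S \<longrightarrow> x $ j = 0} \<Longrightarrow> x \<noteq> 0 \<Longrightarrow> \<delta> * norm x \<le> f x"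
    using positively_homogeneous_bounded_below[OF cont subspace_supported hom pos] by blast
  \<comment> \<open>This bounds \<open>f\<close> on the feasible set: the first two terms come from
    the triangle inequality for A x = (A x - y) + y, the sum from B x \<le> b. The absolute values
    make \<open>M\<close> nonnegative, which settles x = 0.\<close>
  define M where "M = \<bar>\<epsilon>\<bar> + norm y + (\<Sum>i\<in>UNIV. \<bar>b $ i\<bar>)"
  have "M \<ge> 0" unfolding M_def by (intro add_nonneg_nonneg sum_nonneg) auto
  have "norm x \<le> M / \<delta>"
    if x: "x \<in> feasible_set A y \<epsilon> B b" "\<forall>j. j \<notin> S \<longrightarrow> x $ j = 0" for x
  proof (cases "x = 0")
    case True
    then show ?thesis using \<open>M \<ge> 0\<close> \<delta>(1) by simp
  next
    case False
    have "norm (A *v x) \<le> \<bar>\<epsilon>\<bar> + norm y"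
      using x(1) norm_triangle_sub[of "A *v x" y] by (auto simp: feasible_set_def norm_minus_commute)
    moreover have "max 0 ((B *v x) $ i) \<le> \<bar>b $ i\<bar>" for i
    proof -
      have "(B *v x) $ i \<le> b $ i"
        using x(1) by (simp add: feasible_set_def less_eq_vec_def)
      then show ?thesis by simp
    qed
    ultimately have "f x \<le> M"
      unfolding f_def M_def by (intro add_mono sum_mono) auto
    with \<delta>(2)[of x] x(2) False have "\<delta> * norm x \<le> M" by simp
    then show ?thesis using \<delta>(1) by (simp add: field_simps)
  qed
  then show ?thesis unfolding bounded_iff by blast
qed

text \<open>This links condition (E1), which concerns functions on \<open>S\<close>, to full vectors
  supported in \<open>S\<close>.\<close>

lemma submatrix_vector_mult_restrict:
  fixes A :: "real ^ 'n ^ 'm"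
  assumes "\<forall>j. j \<notin> S \<longrightarrow> x $ j = 0"
  shows "submatrix_vector_mult A S (\<lambda>j\<in>S. x $ j) = A *v x"
  using assms unfolding submatrix_vector_mult_def matrix_vector_mult_def
  by (auto simp: vec_eq_iff intro!: sum.mono_neutral_cong_left)

lemma independent_columns_kernel:
  fixes A :: "real ^ 'n ^ 'm"
  assumes "independent_columns A S" and supp: "\<forall>j. j \<notin> S \<longrightarrow> x $ j = 0" and "A *v x = 0"
  shows "x = 0"
proof -
  have inj: "inj_on (\<lambda>j. column j A) S" and ind: "independent ((\<lambda>j. column j A) ` S)"
    using assms(1) by (auto simp: independent_columns_def)
  \<comment> \<open>\<open>independent\<close> takes coefficients indexed by vectors, not by
    positions. Injectivity of the column map lets \<open>u\<close> carry the entries of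
    \<open>x\<close> over to the columns.\<close>
  define u where "u v = x $ (inv_into S (\<lambda>j. column j A) v)" for v
  have u: "u (column j A) = x $ j" if "j \<in> S" for j
    using inv_into_f_f[OF inj that] by (simp add: u_def)
  have "(\<Sum>v\<in>(\<lambda>j. column j A) ` S. u v *\<^sub>R v) = (\<Sum>j\<in>S. x $ j *\<^sub>R column j A)"
    by (simp add: sum.reindex[OF inj] u)
  also have "\<dots> = A *v x"
    unfolding matrix_mult_sum scalar_mult_eq_scaleR
    using supp by (intro sum.mono_neutral_left) auto
  finally have "\<forall>v\<in>(\<lambda>j. column j A) ` S. u v = 0"
    using independentD[OF ind, of "(\<lambda>j. column j A) ` S" u] assms(3) by auto
  with u supp show ?thesis by (auto simp: vec_eq_iff)
qed

text \<open>A dependent \<open>S\<close> would enter the infimum and force \<open>spark A\<close>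
  down to at most \<open>card S\<close>. Thus (E3) yields (E2).\<close>

lemma independent_columns_less_spark: "enat (card S) < spark A \<Longrightarrow> independent_columns A S"
  unfolding spark_def using INF_lower[of S "{S. \<not> independent_columns A S}" "\<lambda>S. enat (card S)"]
  by (metis leD mem_Collect_eq)

theorem lemma4p2:
  fixes A :: "real ^ 'n ^ 'm" and B :: "real ^ 'n ^ 'l"
    and y :: "real ^ 'm" and b :: "real ^ 'l"
    and \<epsilon> :: real and k :: enat
  assumes "CARD('m) < CARD('n)" and "CARD('l) \<le> CARD('n)"
    and "\<epsilon> \<ge> 0"
    and "k = P0_value A y \<epsilon> B b"
    and "(\<forall>S. enat (card S) = k \<longrightarrow>
            {\<eta> \<in> subvectors S. submatrix_vector_mult A S \<eta> = 0}
              \<inter> {\<eta> \<in> subvectors S. submatrix_vector_mult B S \<eta> \<le> 0} = {subvector_zero S})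
       \<or> (\<forall>S. enat (card S) = k \<longrightarrow> independent_columns A S)
       \<or> k < spark A"
  shows "bounded (sparsest_solutions A y \<epsilon> B b)"
proof -
  have trivial: "x = 0"
    if S: "enat (card S) = k" and supp: "\<forall>j. j \<notin> S \<longrightarrow> x $ j = 0" and "A *v x = 0" "B *v x \<le> 0"
    for S x
  \<comment> \<open>Independent columns already make the kernel trivial. If they are dependent,
    \<open>S\<close> refutes both (E2) and (E3), so (E1) must hold.\<close>
  proof (cases "independent_columns A S")
    case True
    then show ?thesis using independent_columns_kernel that by blast
  next
    case False
    then have "\<not> k < spark A"
      using S independent_columns_less_spark by blast
    with False S assms(5) have E1: "{\<eta> \<in> subvectors S. submatrix_vector_mult A S \<eta> = 0}
        \<inter> {\<eta> \<in> subvectors S. submatrix_vector_mult B S \<eta> \<le> 0} = {subvector_zero S}"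
      by blast
    have "(\<lambda>j\<in>S. x $ j) \<in> subvectors S"
      by (simp add: subvectors_def)
    then have "(\<lambda>j\<in>S. x $ j) \<in> {subvector_zero S}"
      unfolding E1[symmetric] using that by (simp add: submatrix_vector_mult_restrict)
    then have "x $ j = 0" if "j \<in> S" for j
      using that by (metis restrict_apply' singletonD subvector_zero_def)
    with supp show ?thesis by (auto simp: vec_eq_iff)
  qed
  \<comment> \<open>The union is finite because the index type is. For an infeasible problem k =
    \<infinity>, and the union is empty.\<close>
  have "bounded (\<Union>S\<in>{S. enat (card S) = k}.
      feasible_set A y \<epsilon> B b \<inter> {x. \<forall>j. j \<notin> S \<longrightarrow> x $ j = 0})"
    using trivial by (intro bounded_UN ballI bounded_feasible_supported) auto
  moreover have "sparsest_solutions A y \<epsilon> B b \<subseteq> (\<Union>S\<in>{S. enat (card S) = k}.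
      feasible_set A y \<epsilon> B b \<inter> {x. \<forall>j. j \<notin> S \<longrightarrow> x $ j = 0})"
  proof
    fix x assume "x \<in> sparsest_solutions A y \<epsilon> B b"
    then have "enat (card {i. x $ i \<noteq> 0}) = k" "x \<in> feasible_set A y \<epsilon> B b"
      using assms(4) by (auto simp: sparsest_solutions_def l0norm_def feasible_set_def)
    then show "x \<in> (\<Union>S\<in>{S. enat (card S) = k}.
        feasible_set A y \<epsilon> B b \<inter> {x. \<forall>j. j \<notin> S \<longrightarrow> x $ j = 0})"
      \<comment> \<open>The witness is the support of \<open>x\<close>, which has \<open>k\<close>
        elements by optimality.\<close>
      by (intro UN_I[of "{i. x $ i \<noteq> 0}"]) auto
  qed
  ultimately show ?thesis by (rule bounded_subset)
qed

end
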